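(* For all integers $k,n$ with $2\le k\le n$, there exists a graph $G$ of order $n$ with $\chi_i(G)=k$.
   Context: All graphs are finite, simple, undirected and connected. Private neighbors. For $S\subseteq V(G)$ and $v\in S$, $pn[v,S]=N[v]\setminus \bigcup_{u\in S\setminus\{v\}}N[u]$, where $N[\cdot]$ is the closed neighborhood. Irredundance. $S$ is irredundant if $pn[v,S]\ne\emptyset$ for all $v\in S$. It is maximal irredundant if $S$ is irredundant and no proper superset $S\cup\{w\}$ is irredundant. Irredundance coloring. An irredundance coloring of $G$ is a proper coloring for which some maximal irredundant set has all its vertices colored pairwise differently. $\chi_i(G)$ is the minimum number of colors in an irredundance coloring. *)

theory Defs
  imports "Graph_Theory.Pair_Digraph" "Graph_Theory.Digraph_Component"
begin

text \<open>
  A finite simple undirected graph is a \<^locale>\<open>pair_graph\<close>: the edge \<open>uv\<close> is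
  represented by the two arcs \<open>(u, v)\<close> and \<open>(v, u)\<close>.
\<close>

definition closed_nbhd :: "'a pair_pre_digraph \<Rightarrow> 'a \<Rightarrow> 'a set" where
  "closed_nbhd G v = insert v {u. (v, u) \<in> parcs G}"

definition private_nbhd :: "'a pair_pre_digraph \<Rightarrow> 'a \<Rightarrow> 'a set \<Rightarrow> 'a set" where
  "private_nbhd G v S = closed_nbhd G v - (\<Union>u\<in>S - {v}. closed_nbhd G u)"

definition irredundant :: "'a pair_pre_digraph \<Rightarrow> 'a set \<Rightarrow> bool" where
  "irredundant G S \<longleftrightarrow> S \<subseteq> pverts G \<and> (\<forall>v\<in>S. private_nbhd G v S \<noteq> {})"

definition maximal_irredundant :: "'a pair_pre_digraph \<Rightarrow> 'a set \<Rightarrow> bool" where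
  "maximal_irredundant G S \<longleftrightarrow>
     irredundant G S \<and> (\<forall>w\<in>pverts G - S. \<not> irredundant G (S \<union> {w}))"

definition proper_coloring :: "'a pair_pre_digraph \<Rightarrow> ('a \<Rightarrow> nat) \<Rightarrow> bool" where
  "proper_coloring G c \<longleftrightarrow> (\<forall>(u, v)\<in>parcs G. c u \<noteq> c v)"

definition irredundance_coloring :: "'a pair_pre_digraph \<Rightarrow> ('a \<Rightarrow> nat) \<Rightarrow> bool" where
  "irredundance_coloring G c \<longleftrightarrow>
     proper_coloring G c \<and> (\<exists>S. maximal_irredundant G S \<and> inj_on c S)"

text \<open>
  Only colors that occur on vertices are counted. For a finite loop-free graph the minimum
  exists: an injective coloring is an irredundance coloring.
\<close>

definition irredundance_chromatic_number :: "'a pair_pre_digraph \<Rightarrow> nat" where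
  "irredundance_chromatic_number G =
     (LEAST m. \<exists>c. irredundance_coloring G c \<and> card (c ` pverts G) = m)"

end

theory Submission
  imports Defs
begin

text \<open>
  The witness is the join of a complete graph on \<open>k - 1\<close> vertices with \<open>n - k + 1\<close> isolated
  vertices. A universal vertex on its own is a maximal irredundant set, so every proper coloring
  of this graph is an irredundance coloring, and the number sought is the ordinary chromatic
  number.
\<close>

text \<open>Since \<open>closed_nbhd G u\<close> contains every vertex, a further vertex
  \<open>w\<close> has no private neighbor in \<open>{u, w}\<close>. On its own, \<open>u\<close> is
  its own private neighbor.\<close>

lemma universal_singleton_maximal_irredundant:
  assumes "u \<in> pverts G" and "pverts G \<subseteq> closed_nbhd G u" and "parcs G \<subseteq> pverts G \<times> pverts G"
  shows "maximal_irredundant G {u}"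
  unfolding maximal_irredundant_def
proof (intro conjI ballI)
  show "irredundant G {u}"
    using assms(1) by (auto simp: irredundant_def private_nbhd_def closed_nbhd_def)
next
  fix w assume w: "w \<in> pverts G - {u}"
  then have "closed_nbhd G w \<subseteq> closed_nbhd G u"
    using assms(2,3) by (auto simp: closed_nbhd_def)
  with w have "private_nbhd G w ({u} \<union> {w}) = {}"
    by (auto simp: private_nbhd_def)
  then show "\<not> irredundant G ({u} \<union> {w})"
    unfolding irredundant_def by blast
qed

text \<open>For \<open>m \<le> n\<close> this is a complete split graph: the vertices below
  \<open>m\<close> form the clique, those from \<open>m\<close> on the independent set.\<close>

definition split_join :: "nat \<Rightarrow> nat \<Rightarrow> nat pair_pre_digraph" where
  "split_join m n = \<lparr>pverts = {..<n},
     parcs = {(u, v). u < n \<and> v < n \<and> u \<noteq> v \<and> (u < m \<or> v < m)}\<rparr>"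

lemma pverts_split_join [simp]: "pverts (split_join m n) = {..<n}"
  by (simp add: split_join_def)

lemma parcs_split_join:
  "(u, v) \<in> parcs (split_join m n) \<longleftrightarrow> u < n \<and> v < n \<and> u \<noteq> v \<and> (u < m \<or> v < m)"
  by (simp add: split_join_def)

lemma pair_graph_split_join: "pair_graph (split_join m n)"
proof
  have "parcs (split_join m n) \<subseteq> {..<n} \<times> {..<n}"
    by (auto simp: parcs_split_join)
  then show "finite (parcs (split_join m n))"
    by (rule finite_subset) simp
qed (auto simp: parcs_split_join symmetric_def intro!: symI)

lemma connected_split_join:
  assumes "0 < m" and "0 < n"
  shows "Digraph_Component.connected (with_proj (split_join m n))"
proof -
  interpret pair_graph "split_join m n" by (rule pair_graph_split_join)
  have to0: "v \<rightarrow>\<^sup>*\<^bsub>with_proj (split_join m n)\<^esub> 0"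
    and from0: "0 \<rightarrow>\<^sup>*\<^bsub>with_proj (split_join m n)\<^esub> v" if "v < n" for v
  proof -
    \<comment> \<open>As \<open>0 < m\<close>, vertex \<open>0\<close> is universal, so any two
      vertices are linked through it.\<close>
    have "v = 0 \<or> ((v, 0) \<in> parcs (split_join m n) \<and> (0, v) \<in> parcs (split_join m n))"
      using that assms by (auto simp: parcs_split_join)
    then show "v \<rightarrow>\<^sup>*\<^bsub>with_proj (split_join m n)\<^esub> 0" "0 \<rightarrow>\<^sup>*\<^bsub>with_proj (split_join m n)\<^esub> v"
      using that by (auto intro: reachable_adjI reachable_refl)
  qed
  show ?thesis
    using assms to0 from0
    by (intro connectedI) (auto intro: reachable_mk_symmetricI reachable_trans)
qed

lemma irredundance_coloring_split_join:
  assumes "0 < m" and "0 < n"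
  shows "irredundance_coloring (split_join m n) c \<longleftrightarrow> proper_coloring (split_join m n) c"
proof -
  have "maximal_irredundant (split_join m n) {0}"
    by (rule universal_singleton_maximal_irredundant)
      (use assms in \<open>auto simp: closed_nbhd_def parcs_split_join\<close>)
  then show ?thesis
    by (auto simp: irredundance_coloring_def)
qed

lemma irredundance_chromatic_number_split_join:
  assumes "0 < m" and "m < n"
  shows "irredundance_chromatic_number (split_join m n) = Suc m"
  unfolding irredundance_chromatic_number_def
proof (rule Least_equality)
  \<comment> \<open>This coloring attains the bound: each clique vertex keeps its own color and all
    independent vertices share color \<open>m\<close>, which occurs because
    \<open>m < n\<close>.\<close>
  have "(\<lambda>v. min v m) ` {..<n} = {..m}"
    using assms(2) by (auto simp: image_iff min_def intro!: bexI)
  moreover have "proper_coloring (split_join m n) (\<lambda>v. min v m)"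
    by (auto simp: proper_coloring_def parcs_split_join)
  ultimately show "\<exists>c. irredundance_coloring (split_join m n) c \<and>
      card (c ` pverts (split_join m n)) = Suc m"
    using assms by (intro exI[of _ "\<lambda>v. min v m"]) (simp add: irredundance_coloring_split_join)
next
  fix j
  assume "\<exists>c. irredundance_coloring (split_join m n) c \<and> card (c ` pverts (split_join m n)) = j"
  then obtain c where c: "proper_coloring (split_join m n) c" and j: "card (c ` {..<n}) = j"
    by (auto simp: irredundance_coloring_def)
  \<comment> \<open>The lower bound comes from a clique of size \<open>Suc m\<close>: the
    \<open>m\<close> universal vertices plus the single independent vertex \<open>m\<close>. Of two
    distinct numbers up to \<open>m\<close>, one is below \<open>m\<close>, so they are
    adjacent.\<close>
  have "inj_on c {..m}"
  proof (rule inj_onI, rule ccontr)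
    fix u v assume "u \<in> {..m}" "v \<in> {..m}" "c u = c v" "u \<noteq> v"
    moreover from this have "(u, v) \<in> parcs (split_join m n)"
      using assms by (auto simp: parcs_split_join)
    ultimately show False
      using c by (auto simp: proper_coloring_def)
  qed
  then have "Suc m = card (c ` {..m})"
    by (simp add: card_image)
  also have "\<dots> \<le> card (c ` {..<n})"
    using assms by (intro card_mono image_mono) auto
  finally show "Suc m \<le> j"
    using j by simp
qed

theorem theorem4:
  fixes k n :: nat
  assumes "2 \<le> k" and "k \<le> n"
  shows "\<exists>G :: nat pair_pre_digraph.
           pair_graph G \<and> Digraph_Component.connected (with_proj G) \<and> card (pverts G) = n \<and>
           irredundance_chromatic_number G = k"
  \<comment> \<open>The color shared by the independent vertices accounts for the shift to
    \<open>k - 1\<close>. Here \<open>2 \<le> k\<close> provides a universal vertex, and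
    \<open>k \<le> n\<close> leaves at least one independent vertex.\<close>
  using assms
  by (intro exI[of _ "split_join (k - 1) n"])
    (simp add: pair_graph_split_join connected_split_join irredundance_chromatic_number_split_join)

end
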